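(* Fix a real number $x \ge 1$. Let $S, T$ be two strings over an alphabet $\Sigma$ with $|S| = n$, $|T| = m$ and $m \le n$. Then there exists a data structure for the Suffixes Hamming Distance Oracle problem on $S$ and $T$ whose preprocessing time is $O\!\left(\frac{n}{x}\cdot T_{\mathsf{HD}}(m, x, \Sigma)\right)$ and whose query time is $O(\min(m, x))$.
   Context: For $i,j\in\mathbb{N}$, $[i..j]=\{k\in\mathbb{N}: i\le k\le j\}$ and $[i]=[1..i]$. For a string $S=S[1]S[2]\cdots S[n]$, $S[i..j]=S[i]S[i+1]\cdots S[j]$. For two strings $A,B$ of the same length $\ell$, the Hamming distance is $\mathsf{HD}(A,B)=|\{k\in[\ell]: A[k]\ne B[k]\}|$. For strings $A,B$ of possibly different lengths $a,b$, define $\mathsf{HD}(A,B)=\mathsf{HD}(A[1..\min\{a,b\}],B[1..\min\{a,b\}])$. The Suffixes Hamming Distance Oracle problem: given $S\in\Sigma^*$ of length $n$ and $T\in\Sigma^*$ of length $m$, preprocess them into a data structure that answers queries of the form: given $i\in[n]$ and $j\in[m]$, return $\mathsf{HD}(S[i..n],T[j..m])$. The Text-to-Pattern Hamming Distance problem: given a text of length $N$ and a pattern $P$ of length $M$ over $\Sigma$, compute for every alignment position $j$ the Hamming distance between $P$ and the length-$M$ substring of the text starting at $j$; $T_{\mathsf{HD}}(N, M, \Sigma)$ denotes the time complexity of (an algorithm for) this problem with text length $N$, pattern length $M$, both strings over $\Sigma$. *)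

theory Defs
  imports Complex_Main
begin

section \<open>Hamming distance\<close>

text \<open>
  Strings are lists over an alphabet of machine integers. Lists are indexed from 0, so
  \<open>A ! k\<close> is the letter number \<open>k + 1\<close>, and the suffix starting at letter number \<open>i \<ge> 1\<close>
  is \<open>drop (i - 1) A\<close>. For different lengths the longer string is truncated.
\<close>

definition HD :: "'a list \<Rightarrow> 'a list \<Rightarrow> nat" where
  "HD A B = card {k. k < min (length A) (length B) \<and> A ! k \<noteq> B ! k}"


section \<open>Word RAM programs\<close>

text \<open>
  The machine model is a word RAM with words of \<open>w\<close> bits, programmed in a structured language.
  A state has scalar variables holding one word each and array variables holding finite
  sequences of words; both are named by natural numbers, and one program mentions only finitely
  many of them. Arithmetic is modulo \<open>2 ^ w\<close>. Array accesses are bounds-checked: reading outside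
  an array gives 0, and writing outside it has no effect (this is what \<open>list_update\<close> does).
\<close>

datatype binop = Plus | Minus | Times | Div | Mod | And | Or | Xor | Shl | Shr | Less | Equal

datatype expr =
    Const nat
  | Var nat
  | Len nat
  | Read nat expr
  | Bin binop expr expr

datatype com =
    Skip
  | Assign nat expr
  | Write nat expr expr
  | Alloc nat expr
  | Seq com com
  | If expr com com
  | While expr com
  | Call nat com "nat list"

record state =
  scal :: "nat \<Rightarrow> nat"
  arr :: "nat \<Rightarrow> nat list"

fun binop_sem :: "nat \<Rightarrow> binop \<Rightarrow> nat \<Rightarrow> nat \<Rightarrow> nat" where
  "binop_sem w Plus a b = (a + b) mod 2 ^ w"
| "binop_sem w Minus a b = nat ((int a - int b) mod 2 ^ w)"
| "binop_sem w Times a b = (a * b) mod 2 ^ w"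
| "binop_sem w Div a b = a div b"
| "binop_sem w Mod a b = a mod b"
| "binop_sem w And a b = Bit_Operations.and a b"
| "binop_sem w Or a b = Bit_Operations.or a b"
| "binop_sem w Xor a b = Bit_Operations.xor a b"
| "binop_sem w Shl a b = push_bit b a mod 2 ^ w"
| "binop_sem w Shr a b = drop_bit b a"
| "binop_sem w Less a b = of_bool (a < b) mod 2 ^ w"
| "binop_sem w Equal a b = of_bool (a = b) mod 2 ^ w"

fun eval :: "nat \<Rightarrow> state \<Rightarrow> expr \<Rightarrow> nat" where
  "eval w s (Const c) = c mod 2 ^ w"
| "eval w s (Var x) = scal s x"
| "eval w s (Len a) = length (arr s a) mod 2 ^ w"
| "eval w s (Read a e) =
     (let i = eval w s e in if i < length (arr s a) then arr s a ! i else 0)"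
| "eval w s (Bin f e1 e2) = binop_sem w f (eval w s e1) (eval w s e2)"

text \<open>Every node of an expression costs one time unit.\<close>

fun ecost :: "expr \<Rightarrow> nat" where
  "ecost (Const c) = 1"
| "ecost (Var x) = 1"
| "ecost (Len a) = 1"
| "ecost (Read a e) = 1 + ecost e"
| "ecost (Bin f e1 e2) = 1 + ecost e1 + ecost e2"

text \<open>
  A program starts with its argument arrays in the array variables \<open>0, 1, \<dots>\<close>; all other arrays
  are empty and all scalars are 0.
\<close>

definition entry :: "nat list list \<Rightarrow> state" where
  "entry args = \<lparr>scal = (\<lambda>_. 0), arr = (\<lambda>a. if a < length args then args ! a else [])\<rparr>"

definition input_size :: "nat list list \<Rightarrow> nat" where
  "input_size args = sum_list (map length args)"

text \<open>
  \<open>exec w p s t s'\<close>: on a machine with \<open>w\<close>-bit words, program \<open>p\<close> started in state \<open>s\<close> halts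
  after time \<open>t\<close> in state \<open>s'\<close>. Execution is deterministic. Besides the evaluation of expressions
  and one unit per elementary command, time is charged for every array cell that is initialised:
  \<open>Alloc a e\<close> makes \<open>a\<close> a fresh zero array and costs its length, and \<open>Call r p as\<close>, which runs \<open>p\<close>
  in a separate memory on fresh copies of the arrays \<open>as\<close>, pays for copying the \<open>k = length as\<close> arguments
  in and for copying the result, found in array \<open>k\<close> of \<open>p\<close>, back into array \<open>r\<close>.
\<close>

inductive exec :: "nat \<Rightarrow> com \<Rightarrow> state \<Rightarrow> nat \<Rightarrow> state \<Rightarrow> bool" for w :: nat where
  Skip: "exec w Skip s 1 s"
| Assign: "exec w (Assign x e) s (1 + ecost e) (s\<lparr>scal := (scal s)(x := eval w s e)\<rparr>)"
| Write: "exec w (Write a e1 e2) s (1 + ecost e1 + ecost e2)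
            (s\<lparr>arr := (arr s)(a := (arr s a)[eval w s e1 := eval w s e2])\<rparr>)"
| Alloc: "exec w (Alloc a e) s (1 + ecost e + eval w s e)
            (s\<lparr>arr := (arr s)(a := replicate (eval w s e) 0)\<rparr>)"
| Seq: "exec w p1 s t1 s' \<Longrightarrow> exec w p2 s' t2 s'' \<Longrightarrow> exec w (Seq p1 p2) s (t1 + t2) s''"
| IfTrue: "eval w s e \<noteq> 0 \<Longrightarrow> exec w p1 s t s' \<Longrightarrow> exec w (If e p1 p2) s (1 + ecost e + t) s'"
| IfFalse: "eval w s e = 0 \<Longrightarrow> exec w p2 s t s' \<Longrightarrow> exec w (If e p1 p2) s (1 + ecost e + t) s'"
| WhileFalse: "eval w s e = 0 \<Longrightarrow> exec w (While e p) s (1 + ecost e) s"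
| WhileTrue: "eval w s e \<noteq> 0 \<Longrightarrow> exec w p s t1 s' \<Longrightarrow> exec w (While e p) s' t2 s''
    \<Longrightarrow> exec w (While e p) s (1 + ecost e + t1 + t2) s''"
| Call: "exec w p (entry (map (arr s) as)) t s'
    \<Longrightarrow> exec w (Call r p as) s
          (1 + input_size (map (arr s) as) + t + length (arr s' (length as)))
          (s\<lparr>arr := (arr s)(r := arr s' (length as))\<rparr>)"

text \<open>
  Words have at least \<open>c * log 2 (v + 2)\<close> bits for every number \<open>v\<close> (length, letter, parameter)
  describing the input. The constant \<open>c\<close> belongs to the algorithm, as usual for word RAMs with
  words of logarithmic size.
\<close>

definition wide :: "nat \<Rightarrow> nat \<Rightarrow> nat list \<Rightarrow> bool" where
  "wide c w vs \<longleftrightarrow> (\<forall>v\<in>set vs. (v + 2) ^ c \<le> 2 ^ w)"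


section \<open>Text-to-Pattern Hamming Distance\<close>

text \<open>
  Entry \<open>j\<close> of the result belongs to the alignment starting at letter number \<open>j + 1\<close> of the text.
  There are no alignments if the pattern is longer than the text.
\<close>

definition TPHD :: "nat list \<Rightarrow> nat list \<Rightarrow> nat list" where
  "TPHD txt pat =
     map (\<lambda>j. HD pat (take (length pat) (drop j txt))) [0..<length txt + 1 - length pat]"

text \<open>
  \<open>A\<close> solves the problem for strings over \<open>\<Sigma>\<close>, in time at most \<open>T_HD N M \<Sigma>\<close> for texts of
  length \<open>N\<close> and patterns of length \<open>M\<close>. The time of an algorithm includes reading its input,
  that is, the term \<open>input_size\<close>; the preprocessing time below is measured in the same way.
\<close>

definition solves_TPHD ::
    "com \<Rightarrow> nat \<Rightarrow> nat set \<Rightarrow> (nat \<Rightarrow> nat \<Rightarrow> nat set \<Rightarrow> real) \<Rightarrow> bool" where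
  "solves_TPHD A c \<Sigma> T_HD \<longleftrightarrow>
     (\<forall>txt pat w. set txt \<subseteq> \<Sigma> \<and> set pat \<subseteq> \<Sigma> \<and> pat \<noteq> [] \<and>
        wide c w (length txt # length pat # txt @ pat) \<longrightarrow>
        (\<exists>t s. exec w A (entry [txt, pat]) t s \<and> arr s 2 = TPHD txt pat \<and>
               real (input_size [txt, pat] + t) \<le> T_HD (length txt) (length pat) \<Sigma>))"


section \<open>Suffixes Hamming Distance Oracle\<close>

text \<open>
  A query \<open>(i, j)\<close> is put into scalars 0 and 1, and the answer is returned in scalar 2. The data
  structure is the memory content left by the preprocessing. Queries may modify it, so
  correctness and query time are required after every finite sequence of earlier queries.
\<close>

definition ask :: "nat \<Rightarrow> nat \<Rightarrow> state \<Rightarrow> state" where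
  "ask i j s = s\<lparr>scal := (scal s)(0 := i, 1 := j)\<rparr>"

inductive after_queries :: "nat \<Rightarrow> com \<Rightarrow> nat \<Rightarrow> nat \<Rightarrow> state \<Rightarrow> state \<Rightarrow> bool"
  for w :: nat and qry :: com and n m :: nat and s0 :: state where
  none: "after_queries w qry n m s0 s0"
| more: "after_queries w qry n m s0 s \<Longrightarrow> i \<in> {1..n} \<Longrightarrow> j \<in> {1..m}
    \<Longrightarrow> exec w qry (ask i j s) t s' \<Longrightarrow> after_queries w qry n m s0 s'"

definition answers_SHD ::
    "nat \<Rightarrow> com \<Rightarrow> nat list \<Rightarrow> nat list \<Rightarrow> state \<Rightarrow> real \<Rightarrow> bool" where
  "answers_SHD w qry S T s0 query_time \<longleftrightarrow>
     (\<forall>s i j. after_queries w qry (length S) (length T) s0 s \<and>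
        i \<in> {1..length S} \<and> j \<in> {1..length T} \<longrightarrow>
        (\<exists>t s'. exec w qry (ask i j s) t s' \<and>
                scal s' 2 = HD (drop (i - 1) S) (drop (j - 1) T) \<and> real t \<le> query_time))"

text \<open>
  The preprocessing receives \<open>S\<close>, \<open>T\<close> and the trade-off parameter. A machine cannot take a real
  number \<open>x\<close> as input, so it gets an integer \<open>X\<close> obtained by rounding \<open>x\<close>.
\<close>

definition SHD_oracle ::
    "nat \<Rightarrow> com \<Rightarrow> com \<Rightarrow> nat list \<Rightarrow> nat list \<Rightarrow> nat \<Rightarrow> real \<Rightarrow> real \<Rightarrow> bool" where
  "SHD_oracle w pre qry S T X preprocessing_time query_time \<longleftrightarrow>
     (\<exists>t s. exec w pre (entry [S, T, [X]]) t s \<and>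
            real (input_size [S, T, [X]] + t) \<le> preprocessing_time \<and>
            answers_SHD w qry S T s query_time)"

end

(*
  Cut S into K = n div X full blocks of length X and let D[k, j] be the number of mismatches
  between S from block k on and T from position j on, restricted to whole blocks of S that still
  lie opposite T. One call of the given algorithm with pattern "block k" and text T yields all
  mismatch counts of that block, and D[k, j] is such a count plus D[k + 1, j + X]; so the rows of
  D are filled from k = K - 1 downwards with K calls. A query compares letters up to the next
  block boundary of S, reads one entry of D to jump over all whole blocks, and compares the
  remaining letters: each of the two comparisons takes at most min(m, X) steps.
*)
theory Submission
  imports Defs
begin


section \<open>Time-bounded execution\<close>

text \<open>The time is an upper bound rather than exact, so that cost estimates can be rounded up.
  A \<open>runs\<close> statement may itself serve as the postcondition \<open>Q\<close>, which is
  how commands are chained.\<close>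

definition runs :: "nat \<Rightarrow> com \<Rightarrow> state \<Rightarrow> nat \<Rightarrow> (state \<Rightarrow> bool) \<Rightarrow> bool" where
  "runs w p s t Q \<longleftrightarrow> (\<exists>t' s'. exec w p s t' s' \<and> t' \<le> t \<and> Q s')"

lemma runs_mono:
  assumes "runs w p s t Q" "t \<le> t'" "\<And>s'. Q s' \<Longrightarrow> R s'"
  shows "runs w p s t' R"
  using assms unfolding runs_def by (meson le_trans)

lemma runs_Skip: "1 \<le> t \<Longrightarrow> Q s \<Longrightarrow> runs w Skip s t Q"
  unfolding runs_def using exec.Skip by blast

lemma runs_Assign:
  "1 + ecost e \<le> t \<Longrightarrow> Q (s\<lparr>scal := (scal s)(x := eval w s e)\<rparr>) \<Longrightarrow> runs w (Assign x e) s t Q"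
  unfolding runs_def using exec.Assign by blast

lemma runs_Write:
  "1 + ecost e1 + ecost e2 \<le> t \<Longrightarrow>
   Q (s\<lparr>arr := (arr s)(a := (arr s a)[eval w s e1 := eval w s e2])\<rparr>) \<Longrightarrow>
   runs w (Write a e1 e2) s t Q"
  unfolding runs_def using exec.Write by blast

lemma runs_Alloc:
  "1 + ecost e + eval w s e \<le> t \<Longrightarrow>
   Q (s\<lparr>arr := (arr s)(a := replicate (eval w s e) 0)\<rparr>) \<Longrightarrow> runs w (Alloc a e) s t Q"
  unfolding runs_def using exec.Alloc by blast

lemma runs_Seq:
  assumes "runs w p1 s t1 (\<lambda>s'. runs w p2 s' t2 Q)" "t1 + t2 \<le> t"
  shows "runs w (Seq p1 p2) s t Q"
proof -
  obtain u1 s1 u2 s2 where "exec w p1 s u1 s1" "u1 \<le> t1" "exec w p2 s1 u2 s2" "u2 \<le> t2" "Q s2"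
    using assms(1) unfolding runs_def by blast
  then show ?thesis
    unfolding runs_def using assms(2) exec.Seq[of w p1 s u1 s1 p2 u2 s2]
    by (intro exI[of _ "u1 + u2"] exI[of _ s2]) simp
qed

lemma runs_If:
  assumes "eval w s e \<noteq> 0 \<Longrightarrow> runs w p1 s t Q" "eval w s e = 0 \<Longrightarrow> runs w p2 s t Q"
    "1 + ecost e + t \<le> t'"
  shows "runs w (If e p1 p2) s t' Q"
proof (cases "eval w s e = 0")
  case True
  then obtain u s' where "exec w p2 s u s'" "u \<le> t" "Q s'"
    using assms(2) unfolding runs_def by blast
  then show ?thesis
    unfolding runs_def using True assms(3) exec.IfFalse[of w s e p2 u s' p1]
    by (intro exI[of _ "1 + ecost e + u"] exI[of _ s']) simp
next
  case False
  then obtain u s' where "exec w p1 s u s'" "u \<le> t" "Q s'"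
    using assms(1) unfolding runs_def by blast
  then show ?thesis
    unfolding runs_def using False assms(3) exec.IfTrue[of w s e p1 u s' p2]
    by (intro exI[of _ "1 + ecost e + u"] exI[of _ s']) simp
qed

text \<open>Induction on the number \<open>N - i\<close> of remaining rounds. Each round pays for
  its guard and its body; the summand outside the product pays for the guard that finally
  fails.\<close>

lemma runs_While:
  assumes step: "\<And>i s. i < N \<Longrightarrow> I i s \<Longrightarrow> eval w s e \<noteq> 0 \<and> runs w p s t (I (Suc i))"
    and stop: "\<And>s. I N s \<Longrightarrow> eval w s e = 0"
    and "I i s" "i \<le> N"
  shows "runs w (While e p) s ((N - i) * (1 + ecost e + t) + 1 + ecost e) (I N)"
  using assms(3,4)
proof (induction "N - i" arbitrary: i s)
  case 0
  then have "i = N" by simp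
  then show ?case
    unfolding runs_def using 0 stop exec.WhileFalse[of w s e p]
    by (intro exI[of _ "1 + ecost e"] exI[of _ s]) simp
next
  case (Suc d)
  then have "i < N" by simp
  then obtain u1 s1 where 1: "exec w p s u1 s1" "u1 \<le> t" "I (Suc i) s1" "eval w s e \<noteq> 0"
    using step Suc.prems unfolding runs_def by blast
  have "runs w (While e p) s1 ((N - Suc i) * (1 + ecost e + t) + 1 + ecost e) (I N)"
    using Suc 1 \<open>i < N\<close> by simp
  then obtain u2 s2 where 2: "exec w (While e p) s1 u2 s2"
    "u2 \<le> (N - Suc i) * (1 + ecost e + t) + 1 + ecost e" "I N s2"
    unfolding runs_def by blast
  have "N - i = Suc (N - Suc i)"
    using \<open>i < N\<close> by simp
  then have "1 + ecost e + u1 + u2 \<le> (N - i) * (1 + ecost e + t) + 1 + ecost e"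
    using 1(2) 2(2) by simp
  then show ?case
    unfolding runs_def using exec.WhileTrue[OF 1(4) 1(1) 2(1)] 2(3) by blast
qed

lemma runs_Call:
  assumes "exec w p (entry (map (arr s) as)) u s'"
    "1 + input_size (map (arr s) as) + u + length (arr s' (length as)) \<le> t"
    "Q (s\<lparr>arr := (arr s)(r := arr s' (length as))\<rparr>)"
  shows "runs w (Call r p as) s t Q"
  unfolding runs_def using exec.Call[OF assms(1)] assms(2,3) by blast

section \<open>Symbolic execution of command lists\<close>

fun seq :: "com list \<Rightarrow> com" where
  "seq [] = Skip"
| "seq (p # ps) = Seq p (seq ps)"

declare seq.simps [simp del]

lemma runs_seq_Nil: "1 \<le> t \<Longrightarrow> Q s \<Longrightarrow> runs w (seq []) s t Q"
  by (simp add: seq.simps runs_Skip)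

text \<open>Used backwards, this executes one assignment symbolically: the state is updated and the
  cost is taken off the time budget.\<close>

lemma runs_seq_Assign:
  assumes "runs w (seq ps) (s\<lparr>scal := (scal s)(x := eval w s e)\<rparr>) (t - (1 + ecost e)) Q"
    "1 + ecost e \<le> t"
  shows "runs w (seq (Assign x e # ps)) s t Q"
  using assms by (auto simp: seq.simps intro!: runs_Seq runs_Assign)

lemma runs_seq_Write:
  assumes "runs w (seq ps) (s\<lparr>arr := (arr s)(a := (arr s a)[eval w s e1 := eval w s e2])\<rparr>)
      (t - (1 + ecost e1 + ecost e2)) Q"
    "1 + ecost e1 + ecost e2 \<le> t"
  shows "runs w (seq (Write a e1 e2 # ps)) s t Q"
  using assms by (auto simp: seq.simps intro!: runs_Seq runs_Write)

lemma runs_seq_Cons: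
  assumes "runs w p s t1 R" "\<And>s'. R s' \<Longrightarrow> runs w (seq ps) s' t2 Q" "t1 + t2 \<le> t"
  shows "runs w (seq (p # ps)) s t Q"
  using assms by (auto simp: seq.simps intro!: runs_Seq elim: runs_mono)

lemma runs_seq_then:
  assumes "runs w p s t1 (\<lambda>s'. s' = s1)" "runs w (seq ps) s1 (t - t1) Q" "t1 \<le> t"
  shows "runs w (seq (p # ps)) s t Q"
  using assms by (auto intro!: runs_seq_Cons)

text \<open>A check on the program text that rules out \<open>Write\<close>, \<open>Alloc\<close>
  and \<open>Call\<close>. It serves to show that a query leaves the table intact for later
  queries.\<close>

fun reads_only :: "com \<Rightarrow> bool" where
  "reads_only Skip = True"
| "reads_only (Assign x e) = True"
| "reads_only (Seq p q) = (reads_only p \<and> reads_only q)"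
| "reads_only (If e p q) = (reads_only p \<and> reads_only q)"
| "reads_only (While e p) = reads_only p"
| "reads_only _ = False"

lemma exec_reads_only: "exec w p s t s' \<Longrightarrow> reads_only p \<Longrightarrow> arr s' = arr s"
  by (induction rule: exec.induct) auto

lemma nat_minus_mod_word:
  fixes a b :: nat
  assumes "b \<le> a" "a < 2 ^ w"
  shows "nat ((int a - int b) mod 2 ^ w) = a - b"
proof -
  have "int a < 2 ^ w"
    using assms(2) by (metis of_nat_less_iff of_nat_numeral of_nat_power)
  then have "(int a - int b) mod 2 ^ w = int a - int b"
    using assms(1) by (intro mod_pos_pos_trivial) linarith+
  then show ?thesis
    using assms(1) by simp
qed


section \<open>Counting mismatches by blocks\<close>

text \<open>The Hamming distance of two windows of length \<open>l\<close>, written as a sum so that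
  it splits at any intermediate length.\<close>

definition mism :: "nat list \<Rightarrow> nat list \<Rightarrow> nat \<Rightarrow> nat \<Rightarrow> nat \<Rightarrow> nat" where
  "mism S T a b l = (\<Sum>p<l. of_bool (S ! (a + p) \<noteq> T ! (b + p)))"

lemma mism_0 [simp]: "mism S T a b 0 = 0"
  by (simp add: mism_def)

lemma mism_Suc: "mism S T a b (Suc l) = mism S T a b l + of_bool (S ! (a + l) \<noteq> T ! (b + l))"
  by (simp add: mism_def)

lemma mism_add: "mism S T a b (l + l') = mism S T a b l + mism S T (a + l) (b + l) l'"
  by (induction l') (simp_all add: mism_Suc add.assoc)

lemma mism_le: "mism S T a b l \<le> l"
  by (induction l) (auto simp: mism_Suc)

lemma HD_eq_sum: "HD A B = (\<Sum>p<min (length A) (length B). of_bool (A ! p \<noteq> B ! p))"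
proof -
  have "{k. k < min (length A) (length B) \<and> A ! k \<noteq> B ! k}
      = {..<min (length A) (length B)} \<inter> {k. A ! k \<noteq> B ! k}"
    by auto
  then show ?thesis
    by (simp add: HD_def)
qed

lemma HD_drop: "HD (drop a S) (drop b T) = mism S T a b (min (length S - a) (length T - b))"
  unfolding HD_eq_sum mism_def by (intro sum.cong) auto

text \<open>The block is complete, so the pattern has length \<open>X\<close>, and \<open>j\<close>
  is an existing alignment; hence \<open>HD\<close> truncates nothing.\<close>

lemma nth_TPHD_block:
  assumes "a + X \<le> length S" "j < length T + 1 - X"
  shows "TPHD T (take X (drop a S)) ! j = mism S T a j X"
  using assms unfolding TPHD_def HD_eq_sum mism_def by (auto intro!: sum.cong)

text \<open>The largest multiple of \<open>X\<close> that fits into both remaining suffixes; it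
  makes \<open>blocks\<close> the table entry \<open>D[k, j]\<close>.\<close>

definition skip :: "nat \<Rightarrow> nat list \<Rightarrow> nat list \<Rightarrow> nat \<Rightarrow> nat \<Rightarrow> nat" where
  "skip X S T k j = min (length S - k * X) (length T - j) div X * X"

definition blocks :: "nat \<Rightarrow> nat list \<Rightarrow> nat list \<Rightarrow> nat \<Rightarrow> nat \<Rightarrow> nat" where
  "blocks X S T k j = mism S T (k * X) j (skip X S T k j)"

text \<open>No whole block fits, so the rounded overlap vanishes. This justifies both the cells
  without an alignment, which keep their initial zero, and the missing row after the last
  block.\<close>

lemma blocks_eq_0:
  assumes "length S < k * X + X \<or> length T < j + X"
  shows "blocks X S T k j = 0"
proof -
  have "min (length S - k * X) (length T - j) < X \<or> X = 0"
    using assms by auto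
  then have "skip X S T k j = 0"
    unfolding skip_def by auto
  then show ?thesis
    by (simp add: blocks_def)
qed

text \<open>Passing one block shortens the overlap by exactly \<open>X\<close>, so the rounded
  overlap also loses exactly \<open>X\<close>, and \<open>mism_add\<close> splits off that
  block.\<close>

lemma blocks_step:
  assumes "0 < X" "k * X + X \<le> length S" "j + X \<le> length T"
  shows "blocks X S T k j = mism S T (k * X) j X + blocks X S T (Suc k) (j + X)"
proof -
  have "min (length S - k * X) (length T - j)
      = X + min (length S - Suc k * X) (length T - (j + X))"
    using assms by (auto simp: min_def)
  then have "skip X S T k j = X + skip X S T (Suc k) (j + X)"
    using assms(1) unfolding skip_def by (simp add: div_add_self1)
  then show ?thesis
    by (simp add: blocks_def mism_add add.commute)
qed

lemma blocks_beyond: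
  assumes "0 < X"
  shows "blocks X S T (length S div X) j = 0"
proof (rule blocks_eq_0)
  have "length S div X * X + length S mod X = length S" "length S mod X < X"
    using assms by simp_all
  then show "length S < length S div X * X + X \<or> length T < j + X"
    by linarith
qed

text \<open>Keeps the table entries within a machine word.\<close>

lemma blocks_le: "blocks X S T k j \<le> length S"
proof -
  have "skip X S T k j \<le> min (length S - k * X) (length T - j)"
    unfolding skip_def by (rule div_times_less_eq_dividend)
  then show ?thesis
    unfolding blocks_def using mism_le[of S T "k * X" j "skip X S T k j"] by linarith
qed


section \<open>The programs\<close>

text \<open>
  Scalars of \<open>qry\<close>: 0 and 1 are the 0-based positions \<open>a\<close>, \<open>b\<close>; 2 is the mismatch count; 3 and 4
  are the current offset and the end of a scan; 5 is \<open>X\<close>; 6 is the total length to compare; 7 is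
  the first block starting at or after \<open>a\<close>. In the preprocessing 1 is the row length \<open>m + 1\<close> of the
  table, 2 is \<open>X\<close>, 3 is the block and 4 a loop index; array 3 holds the table, 4 a block and 5 the
  answer of \<open>A\<close>. Row \<open>K\<close> of the table, just after the last block, is not stored: it should be 0,
  which is what an out-of-bounds access returns.
\<close>

definition scan :: com where
  "scan = While (Bin Less (Var 3) (Var 4)) (seq [
     Assign 2 (Bin Plus (Var 2) (Bin Equal (Const 0)
       (Bin Equal (Read 0 (Bin Plus (Var 0) (Var 3))) (Read 1 (Bin Plus (Var 1) (Var 3)))))),
     Assign 3 (Bin Plus (Var 3) (Const 1))])"

definition qry_init :: com where
  "qry_init = seq [
     Assign 0 (Bin Minus (Var 0) (Const 1)),
     Assign 1 (Bin Minus (Var 1) (Const 1)),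
     Assign 2 (Const 0),
     Assign 3 (Const 0),
     Assign 5 (Read 2 (Const 0)),
     Assign 4 (Bin Minus (Len 0) (Var 0)),
     Assign 6 (Bin Minus (Len 1) (Var 1)),
     If (Bin Less (Var 4) (Var 6)) (Assign 6 (Var 4)) Skip]"

text \<open>Adding \<open>X - 1\<close> before the division rounds the quotient up. The distance to
  the block boundary is cut off at the total length to compare.\<close>

definition qry_align :: com where
  "qry_align = seq [
     Assign 7 (Bin Div (Bin Plus (Var 0) (Bin Minus (Var 5) (Const 1))) (Var 5)),
     Assign 4 (Bin Minus (Bin Times (Var 7) (Var 5)) (Var 0)),
     If (Bin Less (Var 6) (Var 4)) (Assign 4 (Var 6)) Skip]"

text \<open>Under this guard letters remain, so the first scan has stopped at a block boundary, the
  only kind of position for which the table has entries.\<close>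

definition qry_jump :: com where
  "qry_jump = If (Bin Less (Var 3) (Var 6)) (seq [
     Assign 2 (Bin Plus (Var 2) (Read 3 (Bin Plus
       (Bin Times (Var 7) (Bin Plus (Len 1) (Const 1))) (Bin Plus (Var 1) (Var 3))))),
     Assign 3 (Bin Plus (Var 3)
       (Bin Times (Bin Div (Bin Minus (Var 6) (Var 3)) (Var 5)) (Var 5)))]) Skip"

definition qry :: com where
  "qry = seq [qry_init, qry_align, scan, qry_jump, Assign 4 (Var 6), scan]"

definition copy_block :: com where
  "copy_block = While (Bin Less (Var 4) (Var 2)) (seq [
     Write 4 (Var 4) (Read 0 (Bin Plus (Bin Times (Var 3) (Var 2)) (Var 4))),
     Assign 4 (Bin Plus (Var 4) (Const 1))])"

definition fill_row :: com where
  "fill_row = While (Bin Less (Var 4) (Len 5)) (seq [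
     Write 3 (Bin Plus (Bin Times (Var 3) (Var 1)) (Var 4))
       (Bin Plus (Read 5 (Var 4))
         (Read 3 (Bin Plus (Bin Times (Bin Plus (Var 3) (Const 1)) (Var 1))
           (Bin Plus (Var 4) (Var 2))))),
     Assign 4 (Bin Plus (Var 4) (Const 1))])"

definition pre_step :: "com \<Rightarrow> com" where
  "pre_step A = seq [
     Assign 3 (Bin Minus (Var 3) (Const 1)),
     Assign 4 (Const 0),
     Alloc 4 (Var 2),
     copy_block,
     Call 5 A [1, 4],
     Assign 4 (Const 0),
     fill_row]"

definition pre :: "com \<Rightarrow> com" where
  "pre A = seq [
     Assign 1 (Bin Plus (Len 1) (Const 1)),
     Assign 2 (Read 2 (Const 0)),
     Assign 3 (Bin Div (Len 0) (Var 2)),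
     Alloc 3 (Bin Times (Var 3) (Var 1)),
     While (Var 3) (pre_step A)]"

lemma reads_only_qry: "reads_only qry"
  by (simp add: qry_def qry_init_def qry_align_def qry_jump_def scan_def seq.simps)

section \<open>The table as a single array, row after row\<close>

definition table :: "nat \<Rightarrow> nat list \<Rightarrow> nat list \<Rightarrow> (nat \<Rightarrow> nat \<Rightarrow> nat) \<Rightarrow> nat list \<Rightarrow> bool" where
  "table X S T f D \<longleftrightarrow> length D = (length S div X) * (length T + 1) \<and>
     (\<forall>k j. k < length S div X \<and> j \<le> length T \<longrightarrow> D ! (k * (length T + 1) + j) = f k j)"

lemma table_index:
  assumes "k < (K::nat)" "j \<le> m"
  shows "k * (m + 1) + j < K * (m + 1)"
proof -
  have "k * (m + 1) + j < Suc k * (m + 1)"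
    using assms(2) by simp
  also have "\<dots> \<le> K * (m + 1)"
    using assms(1) by (intro mult_right_mono) auto
  finally show ?thesis .
qed

text \<open>Distinct cells do not collide: dividing the index by the row length
  \<open>length T + 1\<close> recovers the row.\<close>

lemma table_update:
  assumes "table X S T f D" "k < length S div X" "j \<le> length T"
  shows "table X S T (f(k := (f k)(j := v))) (D[k * (length T + 1) + j := v])"
proof -
  have *: "k' = k \<and> j' = j"
    if "k * (length T + 1) + j = k' * (length T + 1) + j'" "j' \<le> length T" for k' j'
  proof -
    have "(k * (length T + 1) + j) div (length T + 1) = (k' * (length T + 1) + j') div (length T + 1)"
      using that by simp
    then have "k = k'"
      using assms(3) that(2) by (simp only: div_mult_self3 div_less)
    then show ?thesis
      using that by simp
  qed
  show ?thesis
    using assms table_index[OF assms(2,3)] *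
    unfolding table_def by (auto simp: nth_list_update simp del: mult_Suc_right)
qed

text \<open>Row \<open>length S div X\<close> lies just past the end of the array. A read there
  yields the default 0, which is correct because \<open>f\<close> vanishes on that row.\<close>

lemma table_read:
  assumes "table X S T f D" "k \<le> length S div X" "j \<le> length T"
    "\<And>j. f (length S div X) j = 0"
  shows "(if k * (length T + 1) + j < length D then D ! (k * (length T + 1) + j) else 0) = f k j"
proof (cases "k = length S div X")
  case True
  then show ?thesis using assms by (simp add: table_def)
next
  case False
  then have "k < length S div X" using assms(2) by simp
  then show ?thesis
    using assms table_index[of k "length S div X" j "length T"] by (simp add: table_def)
qed

text \<open>The modular semantics as ordinary arithmetic, under side conditions that exclude
  overflow and underflow. From here on these equations take the place of
  \<open>eval.simps\<close>.\<close>

lemma eval_exact: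
  "eval w s (Const 0) = 0"
  "0 < w \<Longrightarrow> eval w s (Const (Suc 0)) = 1"
  "eval w s (Var x) = scal s x"
  "length (arr s a) < 2 ^ w \<Longrightarrow> eval w s (Len a) = length (arr s a)"
  "eval w s (Read a e) =
    (if eval w s e < length (arr s a) then arr s a ! eval w s e else 0)"
  "eval w s e1 + eval w s e2 < 2 ^ w \<Longrightarrow> eval w s (Bin Plus e1 e2) = eval w s e1 + eval w s e2"
  "eval w s e2 \<le> eval w s e1 \<Longrightarrow> eval w s e1 < 2 ^ w \<Longrightarrow>
    eval w s (Bin Minus e1 e2) = eval w s e1 - eval w s e2"
  "eval w s e1 * eval w s e2 < 2 ^ w \<Longrightarrow> eval w s (Bin Times e1 e2) = eval w s e1 * eval w s e2"
  "eval w s (Bin Div e1 e2) = eval w s e1 div eval w s e2"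
  "0 < w \<Longrightarrow> eval w s (Bin Less e1 e2) = of_bool (eval w s e1 < eval w s e2)"
  "0 < w \<Longrightarrow> eval w s (Bin Equal e1 e2) = of_bool (eval w s e1 = eval w s e2)"
  by (simp_all add: nat_minus_mod_word Let_def)

declare eval.simps [simp del]

lemma runs_min:
  assumes "0 < w"
  shows "runs w (If (Bin Less (Var u) (Var v)) (Assign v (Var u)) Skip) s 7
    (\<lambda>s'. s' = s\<lparr>scal := (scal s)(v := min (scal s u) (scal s v))\<rparr>)"
  using assms
  by (intro runs_If[where t = 2] runs_Assign runs_Skip)
    (auto simp: eval_exact min_def split: if_splits)

text \<open>Testing an equality against 0 negates it, so the counter rises exactly at the
  mismatches. A round costs at most 4 for the guard and 20 for the body.\<close>

lemma runs_scan:
  assumes S: "arr s 0 = S" and T: "arr s 1 = T"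
    and v: "scal s 0 = a" "scal s 1 = b" "scal s 2 = mism S T a b p" "scal s 3 = p" "scal s 4 = e"
    and bd: "p \<le> e" "a + e \<le> length S" "b + e \<le> length T" "length S + length T + 1 < 2 ^ w"
  shows "runs w scan s (30 * (e - p) + 5)
    (\<lambda>s'. s' = s\<lparr>scal := (scal s)(2 := mism S T a b e, 3 := e)\<rparr>)"
proof -
  have w: "0 < w"
    using bd(4) by (cases w) auto
  define I where "I = (\<lambda>i s'. s' = s\<lparr>scal := (scal s)(2 := mism S T a b i, 3 := i)\<rparr>)"
  have "runs w scan s ((e - p) * (1 + 3 + 20) + 1 + ecost (Bin Less (Var 3) (Var 4))) (I e)"
    unfolding scan_def
  proof (rule runs_mono[OF runs_While[where N = e and i = p and I = I and t = 20]])
    fix i s' assume i: "i < e" "I i s'"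
    have m: "Suc (mism S T a b i) < 2 ^ w"
      using mism_le[of S T a b i] bd i by linarith
    show "eval w s' (Bin Less (Var 3) (Var 4)) \<noteq> 0 \<and>
      runs w (seq [
     Assign 2 (Bin Plus (Var 2) (Bin Equal (Const 0)
       (Bin Equal (Read 0 (Bin Plus (Var 0) (Var 3))) (Read 1 (Bin Plus (Var 1) (Var 3)))))),
     Assign 3 (Bin Plus (Var 3) (Const 1))]) s' 20 (I (Suc i))"
      using i bd m w unfolding I_def
      by (intro conjI runs_seq_Assign) (simp_all add: eval_exact v[unfolded One_nat_def] S T[unfolded One_nat_def] runs_seq_Nil mism_Suc)
  qed (use w v bd in \<open>auto simp: I_def eval_exact v fun_upd_idem\<close>)
  then show ?thesis
    by (rule runs_mono) (auto simp: I_def)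
qed

lemma word_pos:
  assumes "(n::nat) < 2 ^ w" "0 < n"
  shows "0 < w"
  using assms by (cases w) auto


section \<open>Filling the table\<close>

lemma runs_copy_block:
  assumes S: "arr s 0 = S" and B: "arr s 4 = replicate X 0"
    and v: "scal s 2 = X" "scal s 3 = k" "scal s 4 = 0"
    and bd: "k * X + X \<le> length S" "length S + 1 < 2 ^ w"
  shows "runs w copy_block s (30 * X + 5) (\<lambda>s'. s' = s\<lparr>scal := (scal s)(4 := X),
    arr := (arr s)(4 := take X (drop (k * X) S))\<rparr>)"
proof -
  have w: "0 < w"
    using bd(2) by (rule word_pos) simp
  define I where "I = (\<lambda>i s'. s' = s\<lparr>scal := (scal s)(4 := i),
    arr := (arr s)(4 := take i (drop (k * X) S) @ replicate (X - i) 0)\<rparr>)"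
  \<comment> \<open>Overwriting the first remaining zero extends the copied prefix by one
    letter.\<close>
  have upd: "(take i (drop (k * X) S) @ replicate (X - i) 0)[i := S ! (k * X + i)]
      = take (Suc i) (drop (k * X) S) @ replicate (X - Suc i) 0" if "i < X" for i
    using that bd by (intro nth_equalityI) (auto simp: nth_append nth_list_update)
  have "runs w copy_block s ((X - 0) * (1 + 3 + 20) + 1 + ecost (Bin Less (Var 4) (Var 2))) (I X)"
    unfolding copy_block_def
  proof (rule runs_mono[OF runs_While[where N = X and i = 0 and I = I and t = 20]])
    fix i s' assume i: "i < X" "I i s'"
    have lt: "k * X + i < length S" "k * X < 2 ^ w" "i + 1 < 2 ^ w" "k * X + i < 2 ^ w"
      using i(1) bd by linarith+
    show "eval w s' (Bin Less (Var 4) (Var 2)) \<noteq> 0 \<and>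
      runs w (seq [
        Write 4 (Var 4) (Read 0 (Bin Plus (Bin Times (Var 3) (Var 2)) (Var 4))),
        Assign 4 (Bin Plus (Var 4) (Const 1))]) s' 20 (I (Suc i))"
      using i lt w upd[OF i(1)] unfolding I_def
      by (intro conjI runs_seq_Write runs_seq_Assign runs_seq_Nil) (simp_all add: eval_exact v S)
  qed (use w v in \<open>auto simp: I_def eval_exact B fun_upd_idem\<close>)
  then show ?thesis
    by (rule runs_mono) (auto simp: I_def)
qed

text \<open>Interpolates between the freshly allocated table, at \<open>k = length S div X\<close>,
  and the finished one, at \<open>k = 0\<close>.\<close>

definition done_from :: "nat \<Rightarrow> nat list \<Rightarrow> nat list \<Rightarrow> nat \<Rightarrow> nat \<Rightarrow> nat \<Rightarrow> nat" where
  "done_from X S T k k' j = (if k \<le> k' then blocks X S T k' j else 0)"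

text \<open>Row \<open>k\<close> arises from row \<open>Suc k\<close> by \<open>blocks_step\<close>.
  The final loop index is hidden behind \<open>p\<close>, since it is reset before its next
  use.\<close>

lemma runs_fill_row:
  assumes X: "0 < X"
    and R: "arr s 5 = TPHD T (take X (drop (k * X) S))"
    and D: "table X S T (done_from X S T (Suc k)) (arr s 3)"
    and v: "scal s 1 = length T + 1" "scal s 2 = X" "scal s 3 = k" "scal s 4 = 0"
    and k: "k < length S div X"
    and word: "(length S + 1) * (length T + 1) + length S + length T + X + 2 < 2 ^ w"
  shows "runs w fill_row s (60 * (length T + 1) + 5) (\<lambda>s'. \<exists>D p.
    table X S T (done_from X S T k) D \<and> s' = s\<lparr>scal := (scal s)(4 := p), arr := (arr s)(3 := D)\<rparr>)"
proof -
  let ?m = "length T" and ?L = "length T + 1 - X"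
  have w: "0 < w"
    using word by (rule word_pos) simp
  have "Suc k * X \<le> length S"
    using k X by (simp add: less_eq_div_iff_mult_less_eq Suc_le_eq[symmetric] del: mult_Suc)
  then have kX: "k * X + X \<le> length S"
    by simp
  then have lenR: "length (arr s 5) = ?L"
    by (simp add: R TPHD_def)
  \<comment> \<open>The contents during the loop: all later rows, and the first \<open>i\<close>
    cells of row \<open>k\<close>.\<close>
  define f where "f = (\<lambda>i k' j. if k < k' \<or> k' = k \<and> j < i then blocks X S T k' j else 0)"
  define I where "I = (\<lambda>i s'. \<exists>D. table X S T (f i) D \<and>
    s' = s\<lparr>scal := (scal s)(4 := i), arr := (arr s)(3 := D)\<rparr>)"
  have "runs w fill_row s ((?L - 0) * (1 + 3 + 40) + 1 + ecost (Bin Less (Var 4) (Len 5))) (I ?L)"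
    unfolding fill_row_def
  proof (rule runs_mono[OF runs_While[where N = ?L and i = 0 and I = I and t = 40]])
    fix i s' assume i: "i < ?L" "I i s'"
    then obtain D where D: "table X S T (f i) D"
      and s': "s' = s\<lparr>scal := (scal s)(4 := i), arr := (arr s)(3 := D)\<rparr>"
      by (auto simp: I_def)
    let ?idx = "Bin Plus (Bin Times (Bin Plus (Var 3) (Const 1)) (Var 1)) (Bin Plus (Var 4) (Var 2))"
    have "Suc k \<le> length S"
      using k by (meson Suc_leI div_le_dividend le_trans)
    then have "Suc k * (?m + 1) \<le> (length S + 1) * (?m + 1)"
      by (intro mult_le_mono1) simp
    then have bd: "Suc k * (?m + 1) + (i + X) < 2 ^ w" "k * (?m + 1) + i < 2 ^ w"
      "k + 1 < 2 ^ w" "i + 1 < 2 ^ w"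
    proof -
      have "k * (?m + 1) \<le> Suc k * (?m + 1)" "i + X \<le> ?m"
        using i(1) by auto
      with word \<open>Suc k \<le> length S\<close> \<open>Suc k * (?m + 1) \<le> (length S + 1) * (?m + 1)\<close>
      show "Suc k * (?m + 1) + (i + X) < 2 ^ w" "k * (?m + 1) + i < 2 ^ w"
        "k + 1 < 2 ^ w" "i + 1 < 2 ^ w"
        by linarith+
    qed
    have idx: "eval w s' ?idx = Suc k * (?m + 1) + (i + X)"
      using w bd add_lessD1[OF bd(1)] add_lessD1[of "i + X" "Suc k * (?m + 1)" "2 ^ w"]
      by (simp add: eval_exact s' v v(1)[unfolded One_nat_def] add.commute del: mult_Suc_right)
    have cell: "eval w s' (Read 3 ?idx) = blocks X S T (Suc k) (i + X)"
    proof -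
      have "arr s' 3 = D"
        by (simp add: s')
      \<comment> \<open>For the last block, row \<open>Suc k\<close> is the one that is not stored,
        and the default value of the read has to agree with \<open>f\<close>.\<close>
      moreover have "f i (length S div X) j = 0" for j
        by (simp add: f_def blocks_beyond X)
      then have "(if Suc k * (?m + 1) + (i + X) < length D
        then D ! (Suc k * (?m + 1) + (i + X)) else 0) = f i (Suc k) (i + X)"
        using k i(1) by (intro table_read[OF D]) auto
      ultimately show ?thesis
        by (simp only: eval_exact(5) idx) (simp add: f_def)
    qed
    have val: "eval w s' (Bin Plus (Read 5 (Var 4)) (Read 3 ?idx)) = blocks X S T k i"
    proof -
      have "eval w s' (Read 5 (Var 4)) = mism S T (k * X) i X"
        using i(1) lenR nth_TPHD_block[OF kX i(1)] by (simp add: eval_exact s' R)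
      moreover have "blocks X S T k i = mism S T (k * X) i X + blocks X S T (Suc k) (i + X)"
        using X kX i(1) by (intro blocks_step) auto
      moreover have "blocks X S T k i < 2 ^ w"
        using blocks_le[of X S T k i] word by linarith
      ultimately show ?thesis
        using cell by (simp add: eval_exact(6))
    qed
    have row: "eval w s' (Bin Plus (Bin Times (Var 3) (Var 1)) (Var 4)) = k * (?m + 1) + i"
      using bd(2) add_lessD1[OF bd(2)]
      by (simp add: eval_exact s' v v(1)[unfolded One_nat_def] del: mult_Suc_right)
    have "table X S T ((f i)(k := (f i k)(i := blocks X S T k i)))
        (D[k * (?m + 1) + i := blocks X S T k i])"
      using k i(1) by (intro table_update[OF D]) auto
    moreover have "(f i)(k := (f i k)(i := blocks X S T k i)) = f (Suc i)"
      by (auto simp: f_def fun_eq_iff)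
    ultimately have D': "table X S T (f (Suc i)) (D[k * (?m + 1) + i := blocks X S T k i])"
      by simp
    have "runs w (seq [
        Write 3 (Bin Plus (Bin Times (Var 3) (Var 1)) (Var 4))
          (Bin Plus (Read 5 (Var 4)) (Read 3 ?idx)),
        Assign 4 (Bin Plus (Var 4) (Const 1))]) s' 40 (I (Suc i))"
      apply (rule runs_seq_Write)
       apply (unfold row val)
       apply (intro runs_seq_Assign runs_seq_Nil)
         apply simp
        apply (use w bd(4) D' in \<open>auto simp: I_def s' eval_exact simp del: mult_Suc_right\<close>)
      done
    moreover have "eval w s' (Bin Less (Var 4) (Len 5)) \<noteq> 0"
      using i(1) w lenR word by (simp add: eval_exact s')
    ultimately show "eval w s' (Bin Less (Var 4) (Len 5)) \<noteq> 0 \<and> runs w (seq [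
        Write 3 (Bin Plus (Bin Times (Var 3) (Var 1)) (Var 4))
          (Bin Plus (Read 5 (Var 4)) (Read 3 ?idx)),
        Assign 4 (Bin Plus (Var 4) (Const 1))]) s' 40 (I (Suc i))"
      by blast
  next
    have "f 0 = done_from X S T (Suc k)"
      by (auto simp: f_def done_from_def fun_eq_iff)
    then show "I 0 s"
      unfolding I_def using D v by (intro exI[of _ "arr s 3"]) (simp add: fun_upd_idem)
  next
    fix s' assume "I ?L s'"
    then show "eval w s' (Bin Less (Var 4) (Len 5)) = 0"
      using w lenR word by (auto simp: I_def eval_exact)
  qed auto
  \<comment> \<open>From column \<open>?L\<close> on no whole block fits opposite \<open>T\<close>,
    so the row is complete when the loop stops.\<close>
  moreover have "f ?L = done_from X S T k"
  proof (intro ext)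
    fix k' j
    have "blocks X S T k j = 0" if "\<not> j < ?L"
      using that by (intro blocks_eq_0) linarith
    then show "f ?L k' j = done_from X S T k k' j"
      by (auto simp: f_def done_from_def)
  qed
  ultimately show ?thesis
    by (elim runs_mono) (auto simp: I_def)
qed

text \<open>At \<open>k = 0\<close> this also describes the memory handed to the queries, which read
  the input arrays again.\<close>

definition loop_inv :: "nat \<Rightarrow> nat list \<Rightarrow> nat list \<Rightarrow> nat \<Rightarrow> state \<Rightarrow> bool" where
  "loop_inv X S T k s \<longleftrightarrow> arr s 0 = S \<and> arr s 1 = T \<and> arr s 2 = [X] \<and>
     scal s 1 = length T + 1 \<and> scal s 2 = X \<and> scal s 3 = k \<and>
     table X S T (done_from X S T k) (arr s 3)"

lemma runs_pre_step:
  assumes X: "0 < X"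
    and word: "(length S + 1) * (length T + 1) + length S + length T + X + 2 < 2 ^ w"
    and A: "\<And>pat. length pat = X \<Longrightarrow> set pat \<subseteq> set S \<Longrightarrow>
      \<exists>t s. exec w A (entry [T, pat]) t s \<and> arr s 2 = TPHD T pat \<and> length T + X + t \<le> h"
    and inv: "loop_inv X S T (Suc k) s"
    and k: "k < length S div X"
  shows "runs w (pre_step A) s (h + 40 * X + 70 * (length T + 1) + 100) (loop_inv X S T k)"
proof -
  have w: "0 < w"
    using word by (rule word_pos) simp
  have "Suc k * X \<le> length S"
    using k X by (simp add: less_eq_div_iff_mult_less_eq Suc_le_eq[symmetric] del: mult_Suc)
  then have kX: "k * X + X \<le> length S"
    by simp
  then have "Suc k \<le> length S"
    using \<open>Suc k * X \<le> length S\<close> X by (metis le_trans mult_le_mono2 nat_mult_1_right Suc_leI One_nat_def)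
  then have kw: "Suc k < 2 ^ w"
    using word by linarith
  note inv = inv[unfolded loop_inv_def]
  define blk where "blk = take X (drop (k * X) S)"
  have blk: "length blk = X" "set blk \<subseteq> set S"
    using kX by (auto simp: blk_def dest: in_set_takeD in_set_dropD)
  obtain t u where u: "exec w A (entry [T, blk]) t u" "arr u 2 = TPHD T blk" "length T + X + t \<le> h"
    using A[OF blk] by blast
  define s1 where "s1 = s\<lparr>scal := (scal s)(3 := k, 4 := 0), arr := (arr s)(4 := replicate X 0)\<rparr>"
  define s2 where "s2 = s1\<lparr>scal := (scal s1)(4 := X), arr := (arr s1)(4 := blk)\<rparr>"
  define s3 where "s3 = s2\<lparr>arr := (arr s2)(5 := TPHD T blk)\<rparr>"
  define s4 where "s4 = s3\<lparr>scal := (scal s3)(4 := 0)\<rparr>"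
  have alloc: "runs w (Alloc 4 (Var 2)) (s\<lparr>scal := (scal s)(3 := k, 4 := 0)\<rparr>) (X + 2) (\<lambda>s'. s' = s1)"
    by (rule runs_Alloc) (use inv in \<open>auto simp: eval_exact s1_def\<close>)
  have copy: "runs w copy_block s1 (30 * X + 5) (\<lambda>s'. s' = s2)"
    unfolding s2_def blk_def
    by (rule runs_copy_block) (use inv kX word in \<open>auto simp: s1_def\<close>)
  \<comment> \<open>The bound \<open>h\<close> contains the input size \<open>length T + X\<close>,
    which pays for copying the arguments in; the extra \<open>length T + 2\<close> covers the call
    itself and copying the result back.\<close>
  have call: "runs w (Call 5 A [1, 4]) s2 (h + length T + 2) (\<lambda>s'. s' = s3)"
  proof (rule runs_Call)
    have args: "map (arr s2) [1, 4] = [T, blk]"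
      using inv by (simp add: s2_def s1_def)
    then show "exec w A (entry (map (arr s2) [1, 4])) t u"
      using u(1) by simp
    have "length (TPHD T blk) \<le> length T + 1"
      by (simp add: TPHD_def)
    then show "1 + input_size (map (arr s2) [1, 4]) + t + length (arr u (length [1, 4 :: nat]))
      \<le> h + length T + 2"
      using u args blk(1) by (simp add: input_size_def numeral_2_eq_2)
  qed (use u(2) in \<open>simp add: s3_def numeral_2_eq_2\<close>)
  have fill: "runs w fill_row s4 (60 * (length T + 1) + 5) (\<lambda>s'. \<exists>D p.
    table X S T (done_from X S T k) D \<and> s' = s4\<lparr>scal := (scal s4)(4 := p), arr := (arr s4)(3 := D)\<rparr>)"
    by (rule runs_fill_row) (use X inv k word in \<open>auto simp: s4_def s3_def s2_def s1_def blk_def\<close>)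
  have last: "runs w (seq [fill_row]) s4 (60 * (length T + 1) + 6) (loop_inv X S T k)"
    by (rule runs_seq_Cons[OF fill runs_seq_Nil])
      (use inv in \<open>auto simp: loop_inv_def s4_def s3_def s2_def s1_def\<close>)
  have init: "s\<lparr>scal := (scal s)(3 := eval w s (Bin Minus (Var 3) (Const 1)))\<rparr>
      = s\<lparr>scal := (scal s)(3 := k)\<rparr>"
    "s\<lparr>scal := (scal s)(3 := k)\<rparr>\<lparr>scal := (scal (s\<lparr>scal := (scal s)(3 := k)\<rparr>))
        (4 := eval w (s\<lparr>scal := (scal s)(3 := k)\<rparr>) (Const 0))\<rparr>
      = s\<lparr>scal := (scal s)(3 := k, 4 := 0)\<rparr>"
    "s3\<lparr>scal := (scal s3)(4 := eval w s3 (Const 0))\<rparr> = s4"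
    using inv w kw by (simp_all add: eval_exact s4_def)
  show ?thesis
    unfolding pre_step_def
    apply (rule runs_seq_Assign, unfold init)
     apply (rule runs_seq_Assign, unfold init)
      apply (rule runs_seq_then[OF alloc])
       apply (rule runs_seq_then[OF copy])
        apply (rule runs_seq_then[OF call])
         apply (rule runs_seq_Assign, unfold init)
          apply (rule runs_mono[OF last])
           apply simp_all
    done
qed

lemma runs_pre:
  assumes X: "0 < X"
    and word: "(length S + 1) * (length T + 1) + length S + length T + X + 2 < 2 ^ w"
    and A: "\<And>pat. length pat = X \<Longrightarrow> set pat \<subseteq> set S \<Longrightarrow>
      \<exists>t s. exec w A (entry [T, pat]) t s \<and> arr s 2 = TPHD T pat \<and> length T + X + t \<le> h"
  shows "runs w (pre A) (entry [S, T, [X]])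
    ((length S div X) * (h + 40 * X + 80 * (length T + 1) + 200) + 100) (loop_inv X S T 0)"
proof -
  let ?K = "length S div X" and ?m = "length T"
  have w: "0 < w"
    using word by (rule word_pos) simp
  have "?K * (?m + 1) \<le> (length S + 1) * (?m + 1)"
    by (intro mult_le_mono1) (meson div_le_dividend le_SucI Suc_eq_plus1 le_trans le_add1)
  then have bd: "?K * (?m + 1) < 2 ^ w"
    using word by linarith
  define s1 where "s1 = (entry [S, T, [X]])\<lparr>scal := (\<lambda>_. 0)(1 := ?m + 1, 2 := X, 3 := ?K)\<rparr>"
  define s2 where "s2 = s1\<lparr>arr := (arr s1)(3 := replicate (?K * (?m + 1)) 0)\<rparr>"
  have arrs: "arr (entry [S, T, [X]]) 0 = S" "arr (entry [S, T, [X]]) (Suc 0) = T"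
    "arr (entry [S, T, [X]]) 2 = [X]" "scal (entry [S, T, [X]]) = (\<lambda>_. 0)"
    by (simp_all add: entry_def)
  have alloc: "runs w (Alloc 3 (Bin Times (Var 3) (Var 1))) s1 (?K * (?m + 1) + 10) (\<lambda>s'. s' = s2)"
  proof (rule runs_Alloc)
    have "eval w s1 (Bin Times (Var 3) (Var 1)) = ?K * (?m + 1)"
      using bd by (simp add: eval_exact s1_def del: mult_Suc_right)
    then show "1 + ecost (Bin Times (Var 3) (Var 1)) + eval w s1 (Bin Times (Var 3) (Var 1))
        \<le> ?K * (?m + 1) + 10"
      and "s1\<lparr>arr := (arr s1)(3 := replicate (eval w s1 (Bin Times (Var 3) (Var 1))) 0)\<rparr> = s2"
      by (simp_all add: s2_def)
  qed
  have inv: "loop_inv X S T (?K - 0) s2"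
    using table_index[of _ ?K _ ?m]
    by (auto simp: loop_inv_def s2_def s1_def arrs arrs(2)[unfolded One_nat_def] table_def done_from_def
        simp del: mult_Suc_right)
  have loop: "runs w (While (Var 3) (pre_step A)) s2
      ((?K - 0) * (1 + ecost (Var 3) + (h + 40 * X + 70 * (?m + 1) + 100)) + 1 + ecost (Var 3))
      (loop_inv X S T (?K - ?K))"
  \<comment> \<open>The loop rule counts upwards while the rows are filled downwards, hence the
    reflected index \<open>?K - i\<close>.\<close>
  proof (rule runs_While[where I = "\<lambda>i. loop_inv X S T (?K - i)"])
    fix i s assume i: "i < ?K" "loop_inv X S T (?K - i) s"
    then have inv: "loop_inv X S T (Suc (?K - Suc i)) s" and lt: "?K - Suc i < ?K"
      by (simp_all add: Suc_diff_Suc)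
    show "eval w s (Var 3) \<noteq> 0 \<and>
        runs w (pre_step A) s (h + 40 * X + 70 * (?m + 1) + 100) (loop_inv X S T (?K - Suc i))"
      using runs_pre_step[OF X word A inv lt] i by (auto simp: loop_inv_def eval_exact)
  qed (use inv in \<open>auto simp: loop_inv_def eval_exact\<close>)
  have tail: "runs w (seq [While (Var 3) (pre_step A)]) s2
      (?K * (h + 40 * X + 70 * (?m + 1) + 102) + 3) (loop_inv X S T 0)"
    by (rule runs_seq_Cons[OF loop runs_seq_Nil]) (auto simp: algebra_simps)
  have "runs w (pre A) (entry [S, T, [X]])
    (?K * (?m + 1) + (?K * (h + 40 * X + 70 * (?m + 1) + 102) + 100)) (loop_inv X S T 0)"
    using w word unfolding pre_def
    apply -
    apply (rule runs_seq_Assign)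
     apply (rule runs_seq_Assign)
      apply (rule runs_seq_Assign)
       apply (rule ssubst[of _ s1 "\<lambda>s. runs w _ s _ _"])
        apply (simp add: eval_exact arrs s1_def)
       apply (rule runs_seq_then[OF alloc])
        apply (rule runs_mono[OF tail])
         apply simp_all
    done
  \<comment> \<open>The cost of allocating \<open>?K * (?m + 1)\<close> cells is spread over the
    \<open>?K\<close> rounds; it fits into raising the coefficient 70 to 80.\<close>
  then show ?thesis
    by (rule runs_mono) (simp_all add: algebra_simps)
qed


section \<open>Answering a query\<close>

text \<open>Only the arrays of \<open>s\<close> are prescribed, because earlier queries preserve the
  arrays but change the scalars.\<close>

lemma runs_qry:
  assumes S: "arr s 0 = S" and T: "arr s 1 = T" and X: "arr s 2 = [X]" "0 < X"
    and D: "table X S T (blocks X S T) (arr s 3)"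
    and word: "(length S + 1) * (length T + 1) + length S + length T + X + 2 < 2 ^ w"
    and i: "i \<in> {1..length S}" and j: "j \<in> {1..length T}"
  shows "runs w qry (ask i j s) (60 * min (length T) X + 400)
    (\<lambda>s'. scal s' 2 = HD (drop (i - 1) S) (drop (j - 1) T))"
proof -
  have w: "0 < w"
    using word by (rule word_pos) simp
  have lens: "length S + length T + X + 2 < 2 ^ w"
    using word by linarith
  define a where "a = i - 1"
  define b where "b = j - 1"
  have ab: "a < length S" "b < length T" "i = Suc a" "j = Suc b"
    using i j by (auto simp: a_def b_def)
  define tot where "tot = min (length T - b) (length S - a)"
  \<comment> \<open>The quotient of \<open>a\<close> by \<open>X\<close>, rounded up: the first
    block starting at or after \<open>a\<close>.\<close>
  define k where "k = (a + (X - 1)) div X"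
  define r where "r = min tot (k * X - a)"
  have "k * X + (a + (X - 1)) mod X = a + (X - 1)"
    unfolding k_def by simp
  moreover have "(a + (X - 1)) mod X \<le> X - 1"
    using X(2) by (simp add: less_eq_Suc_le[symmetric] less_Suc_eq_le[symmetric])
  ultimately have k: "a \<le> k * X" "k * X \<le> a + (X - 1)"
    using X(2) by linarith+
  note lookup = S T[unfolded One_nat_def] X(1)
  define s1 where "s1 = s\<lparr>scal := (scal s)(0 := a, 1 := b, 2 := 0, 3 := 0, 5 := X,
    4 := length S - a, 6 := tot)\<rparr>"
  have init: "runs w qry_init (ask i j s) 100 (\<lambda>s'. s' = s1)"
    using w lens ab unfolding qry_init_def ask_def
    apply -
    apply (rule runs_seq_Assign; simp add: eval_exact lookup)+
    apply (rule runs_seq_Cons[OF runs_min[OF w] runs_seq_Nil])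
    apply (rule order_refl)
    apply (simp_all add: s1_def tot_def fun_upd_twist min.commute)
    done
  have k_eq: "k = (a + X - Suc 0) div X"
    using X(2) by (simp add: k_def)
  define s2 where "s2 = s1\<lparr>scal := (scal s1)(7 := k, 4 := r)\<rparr>"
  have align: "runs w qry_align s1 100 (\<lambda>s'. s' = s2)"
    using w lens ab X(2) k k_eq[symmetric] unfolding qry_align_def s1_def
    apply -
    apply (rule runs_seq_Assign; simp add: eval_exact lookup)+
    apply (rule runs_seq_Cons[OF runs_min[OF w] runs_seq_Nil])
      apply (rule order_refl)
     apply (simp_all add: s2_def s1_def r_def fun_upd_twist)
    done
  define s3 where "s3 = s2\<lparr>scal := (scal s2)(2 := mism S T a b r, 3 := r)\<rparr>"
  have r: "r \<le> tot" "r \<le> X"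
    using k X(2) by (auto simp: r_def)
  have tot: "a + tot \<le> length S" "b + tot \<le> length T"
    using ab by (auto simp: tot_def)
  have scan1: "runs w scan s2 (30 * r + 5) (\<lambda>s'. s' = s3)"
    using runs_scan[of s2 S T a b 0 r w] tot r lens by (simp add: s3_def s2_def s1_def lookup)
  \<comment> \<open>The offset after the jump: as many whole blocks as fit into the rest of the
    overlap.\<close>
  define e where "e = r + (tot - r) div X * X"
  define s4 where "s4 = s3\<lparr>scal := (scal s3)(2 := mism S T a b e, 3 := e)\<rparr>"
  have jump: "runs w qry_jump s3 100 (\<lambda>s'. s' = s4)"
  proof (cases "r < tot")
    \<comment> \<open>The overlap is exhausted, so \<open>e = r\<close> and the state stays as it
      is.\<close>
    case False
    then show ?thesis
      using r w unfolding qry_jump_def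
      by (intro runs_If[where t = 50] runs_Skip)
        (auto simp: eval_exact s4_def s3_def s2_def s1_def e_def fun_upd_idem)
  next
    case True
    \<comment> \<open>Letters remain, so the minimum in \<open>r\<close> is the distance to the
      block boundary.\<close>
    then have kX: "a + r = k * X"
      using k by (auto simp: r_def)
    have "min (length S - k * X) (length T - (b + r)) = tot - r"
      unfolding kX[symmetric] by (auto simp: tot_def)
    then have mism_e: "mism S T a b e = mism S T a b r + blocks X S T k (b + r)"
      by (simp add: e_def mism_add blocks_def skip_def kX)
    have e: "(tot - r) div X * X \<le> tot - r"
      by (rule div_times_less_eq_dividend)
    have kK: "k \<le> length S div X"
      using kX True tot X(2) by (simp add: less_eq_div_iff_mult_less_eq)
    have br: "b + r \<le> length T"
      using True tot by simp
    have idx: "k * (length T + 1) + (b + r) < 2 ^ w"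
    proof -
      have "k \<le> length S"
        using kK by (meson div_le_dividend le_trans)
      then have "k * (length T + 1) \<le> length S * (length T + 1)"
        by (rule mult_le_mono1)
      then show ?thesis
        using br word by (simp add: algebra_simps)
    qed
    \<comment> \<open>Here \<open>k\<close> may equal the number of blocks, when only an incomplete
      block of \<open>S\<close> is left; the read then returns the default 0.\<close>
    have cell: "(if k * (length T + 1) + (b + r) < length (arr s 3)
        then arr s 3 ! (k * (length T + 1) + (b + r)) else 0) = blocks X S T k (b + r)"
      using D kK br by (rule table_read) (simp add: blocks_beyond X(2))
    have bd: "mism S T a b e < 2 ^ w" "r + (tot - r) div X * X < 2 ^ w"
      using mism_le[of S T a b e] e r(1) tot lens unfolding e_def by linarith+
    have idx_val: "eval w s3 (Bin Plus (Bin Times (Var 7) (Bin Plus (Len 1) (Const 1)))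
        (Bin Plus (Var 1) (Var 3))) = k * (length T + 1) + (b + r)"
      using w lens idx br add_lessD1[OF idx]
      by (simp add: eval_exact s3_def s2_def s1_def lookup del: mult_Suc_right)
    have val2: "eval w s3 (Bin Plus (Var 2) (Read 3 (Bin Plus
        (Bin Times (Var 7) (Bin Plus (Len 1) (Const 1))) (Bin Plus (Var 1) (Var 3)))))
      = mism S T a b e"
    proof -
      have "arr s3 3 = arr s 3" "scal s3 2 = mism S T a b r"
        by (simp_all add: s3_def s2_def s1_def)
      then have "eval w s3 (Read 3 (Bin Plus (Bin Times (Var 7) (Bin Plus (Len 1) (Const 1)))
          (Bin Plus (Var 1) (Var 3)))) = blocks X S T k (b + r)"
        and "eval w s3 (Var 2) = mism S T a b r"
        using cell by (simp_all only: eval_exact(3,5) idx_val)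
      then show ?thesis
        using mism_e bd(1) by (simp add: eval_exact(6))
    qed
    have val3: "eval w (s3\<lparr>scal := (scal s3)(2 := v)\<rparr>) (Bin Plus (Var 3)
        (Bin Times (Bin Div (Bin Minus (Var 6) (Var 3)) (Var 5)) (Var 5))) = e" for v
      using w bd(2) True tot lens by (simp add: eval_exact s3_def s2_def s1_def e_def)
    have "runs w (seq [
       Assign 2 (Bin Plus (Var 2) (Read 3 (Bin Plus
         (Bin Times (Var 7) (Bin Plus (Len 1) (Const 1))) (Bin Plus (Var 1) (Var 3))))),
       Assign 3 (Bin Plus (Var 3)
         (Bin Times (Bin Div (Bin Minus (Var 6) (Var 3)) (Var 5)) (Var 5)))]) s3 50 (\<lambda>s'. s' = s4)"
      by (intro runs_seq_Assign runs_seq_Nil; (simp only: val2 val3)?) (simp_all add: s4_def)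
    then show ?thesis
      unfolding qry_jump_def
      by (rule runs_If) (use True w in \<open>simp_all add: eval_exact s3_def s2_def s1_def\<close>)
  qed
  have e: "e \<le> tot" "tot - e \<le> X" "r \<le> e"
  proof -
    have "(tot - r) div X * X + (tot - r) mod X = tot - r"
      by simp
    moreover have "(tot - r) mod X < X"
      using X(2) by simp
    ultimately show "e \<le> tot" "tot - e \<le> X" "r \<le> e"
      using r(1) unfolding e_def by linarith+
  qed
  define s5 where "s5 = s4\<lparr>scal := (scal s4)(4 := tot)\<rparr>"
  define s6 where "s6 = s5\<lparr>scal := (scal s5)(2 := mism S T a b tot, 3 := tot)\<rparr>"
  have scan2: "runs w scan s5 (30 * (tot - e) + 5) (\<lambda>s'. s' = s6)"
    using runs_scan[of s5 S T a b e tot w] tot e lens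
    by (simp add: s6_def s5_def s4_def s3_def s2_def s1_def lookup)
  have "runs w qry (ask i j s) (30 * r + 30 * (tot - e) + 400) (\<lambda>s'. s' = s6)"
    unfolding qry_def
  proof (intro runs_seq_then[OF init] runs_seq_then[OF align] runs_seq_then[OF scan1]
      runs_seq_then[OF jump] runs_seq_Assign)
    have s5: "s4\<lparr>scal := (scal s4)(4 := eval w s4 (Var 6))\<rparr> = s5"
      by (simp add: eval_exact s5_def s4_def s3_def s2_def s1_def)
    show "runs w (seq [scan]) (s4\<lparr>scal := (scal s4)(4 := eval w s4 (Var 6))\<rparr>)
      (30 * r + 30 * (tot - e) + 400 - 100 - 100 - (30 * r + 5) - 100 - (1 + ecost (Var 6)))
      (\<lambda>s'. s' = s6)"
      unfolding s5 by (rule runs_seq_then[OF scan2]) (auto intro: runs_seq_Nil)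
  qed auto
  moreover have "scal s6 2 = HD (drop (i - 1) S) (drop (j - 1) T)"
    by (simp add: s6_def HD_drop a_def b_def tot_def min.commute)
  \<comment> \<open>Each scan is no longer than \<open>X\<close> and no longer than the overlap
    \<open>tot\<close>, which is at most \<open>length T\<close>.\<close>
  moreover have "r + (tot - e) \<le> 2 * min (length T) X"
    using r e tot by auto
  ultimately show ?thesis
    by (elim runs_mono) (linarith, simp)
qed


section \<open>The oracle\<close>

lemma after_queries_arr: "after_queries w qry n m s0 s \<Longrightarrow> arr s = arr s0"
  by (induction rule: after_queries.induct)
    (auto simp: ask_def dest: exec_reads_only[OF _ reads_only_qry])

section \<open>Word size, rounding and the preprocessing time\<close>

lemma wide_mono:
  assumes "wide c' w vs" "c \<le> c'" "set us \<subseteq> set vs"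
  shows "wide c w us"
  unfolding wide_def
proof
  fix v assume "v \<in> set us"
  then have "(v + 2) ^ c' \<le> 2 ^ w"
    using assms(1,3) by (auto simp: wide_def)
  moreover have "(v + 2) ^ c \<le> (v + 2) ^ c'"
    using assms(2) by (intro power_increasing) auto
  ultimately show "(v + 2) ^ c \<le> 2 ^ w"
    by (rule order_trans[rotated])
qed

text \<open>With \<open>M\<close> the maximum of \<open>n\<close> and \<open>X\<close>, two of the
  four factors \<open>M + 2\<close> contribute at least 4, and \<open>4 * (M + 2) ^ 2\<close>
  exceeds the quadratic table size plus the linear terms.\<close>

lemma wide_word:
  assumes "wide 4 w [n, X]" "m \<le> n"
  shows "(n + 1) * (m + 1) + n + m + X + 2 < 2 ^ w"
proof -
  define M where "M = max n X"
  have "(M + 2) ^ 4 \<le> 2 ^ w"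
    using assms(1) by (auto simp: wide_def M_def max_def)
  moreover have "(2 + 0) ^ 2 * (M + 2) ^ 2 \<le> (M + 2) ^ 2 * (M + 2) ^ 2"
    by (intro mult_right_mono power_mono) auto
  moreover have "(M + 2) ^ 2 * (M + 2) ^ 2 = (M + 2) ^ 4"
    by (simp flip: power_add)
  moreover have "(n + 1) * (m + 1) \<le> (M + 1) * (M + 1)"
    using assms(2) by (intro mult_mono) (auto simp: M_def)
  moreover have "n \<le> M" "m \<le> M" "X \<le> M"
    using assms(2) by (auto simp: M_def)
  moreover have "(M + 1) * (M + 1) + M + M + M + 2 < 2 ^ 2 * (M + 2) ^ 2"
    by (simp add: power2_eq_square)
  ultimately show ?thesis
    by simp
qed

text \<open>Rounding moves \<open>x\<close> by at most 1, which is at most a factor of 2 since both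
  \<open>x\<close> and \<open>X\<close> are at least 1.\<close>

lemma rounding_bounds:
  fixes x :: real
  assumes "1 \<le> x" "X \<in> {nat \<lfloor>x\<rfloor>, nat \<lceil>x\<rceil>}"
  shows "1 \<le> X" "x \<le> 2 * real X" "real X \<le> 2 * x"
proof -
  have "1 \<le> \<lfloor>x\<rfloor>" "1 \<le> \<lceil>x\<rceil>"
    using assms(1) by linarith+
  then have "real X = of_int \<lfloor>x\<rfloor> \<or> real X = of_int \<lceil>x\<rceil>" and X: "1 \<le> X"
    using assms(2) by (auto simp: le_nat_iff)
  then have "x - 1 \<le> real X" "real X \<le> x + 1" "1 \<le> real X"
    by linarith+
  then show "1 \<le> X" "x \<le> 2 * real X" "real X \<le> 2 * x"
    using X assms(1) by linarith+
qed

lemma pre_time_bound: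
  fixes x H :: real
  assumes "1 \<le> x" "1 \<le> X" "x \<le> 2 * real X" "m \<le> n" "0 < n" "m + X \<le> h" "real h \<le> H"
  shows "real (n + m + 1 + ((n div X) * (h + 40 * X + 80 * (m + 1) + 200) + 100))
    \<le> 1000 * (real n / x * H)"
proof -
  have inv: "1 / real X \<le> 2 / x"
    using assms(1-3) by (simp add: field_simps)
  have "real (n div X) \<le> real n / real X"
    by (simp add: of_nat_div_le_of_nat)
  also have "\<dots> \<le> 2 * (real n / x)"
    using mult_left_mono[OF inv, of "real n"] by (simp add: mult.commute)
  finally have K: "real (n div X) * real h \<le> 2 * (real n / x) * H"
    using assms(1,7) by (intro mult_mono) auto
  \<comment> \<open>Linear costs are absorbed through \<open>X \<le> H\<close>, even if
    \<open>X > n\<close>, when there is no block and hence no call to charge them to.\<close>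
  have "real n \<le> 2 * (real n / x) * real X"
    using assms(1,3) mult_left_mono[OF assms(3), of "real n"] by (simp add: field_simps)
  also have "\<dots> \<le> 2 * (real n / x) * H"
    using assms by (intro mult_left_mono) auto
  finally have n: "real n \<le> 2 * (real n / x) * H" .
  \<comment> \<open>As \<open>1 \<le> X\<close> and \<open>m + X \<le> h\<close>, everything besides
    \<open>h\<close> itself is at most \<open>360 * h\<close>.\<close>
  have "(n div X) * (h + 40 * X + 80 * (m + 1) + 200) \<le> (n div X) * (361 * h)"
    using assms(2,6) by (intro mult_left_mono) auto
  also have "\<dots> = 361 * ((n div X) * h)"
    by simp
  finally have "n + m + 1 + ((n div X) * (h + 40 * X + 80 * (m + 1) + 200) + 100)
      \<le> 103 * n + 361 * ((n div X) * h)"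
    using assms(4,5) by linarith
  then have "real (n + m + 1 + ((n div X) * (h + 40 * X + 80 * (m + 1) + 200) + 100))
      \<le> real (103 * n + 361 * ((n div X) * h))"
    by (rule of_nat_mono)
  also have "\<dots> = 103 * real n + 361 * (real (n div X) * real h)"
    by simp
  also have "\<dots> \<le> 928 * (real n / x * H)"
  proof -
    have "103 * a + 361 * b \<le> 928 * q" if "a \<le> 2 * q" "b \<le> 2 * q" for a b q :: real
      using that by linarith
    then show ?thesis
      using K n by (simp only: mult.assoc)
  qed
  also have "\<dots> \<le> 1000 * (real n / x * H)"
    using assms(1,7) by (intro mult_right_mono mult_nonneg_nonneg) auto
  finally show ?thesis .
qed

lemma oracle_correct:
  assumes A: "solves_TPHD A c \<Sigma> T_HD"
    and x: "1 \<le> x" "X \<in> {nat \<lfloor>x\<rfloor>, nat \<lceil>x\<rceil>}"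
    and ST: "set S \<subseteq> \<Sigma>" "set T \<subseteq> \<Sigma>" "length T \<le> length S" "0 < length S"
    and wide: "wide (c + 4) w (length S # length T # X # S @ T)"
  shows "SHD_oracle w (pre A) qry S T X
    (1000 * (real (length S) / x * T_HD (length T) X \<Sigma>)) (1000 * min (real (length T)) x)"
proof -
  let ?n = "length S" and ?m = "length T"
  define H where "H = T_HD ?m X \<Sigma>"
  \<comment> \<open>The cost rules count in natural numbers, while the given time bound is
    real.\<close>
  define h where "h = nat \<lfloor>H\<rfloor>"
  note X = rounding_bounds[OF x]
  have word: "(?n + 1) * (?m + 1) + ?n + ?m + X + 2 < 2 ^ w"
    using wide ST(3) by (intro wide_word wide_mono[OF wide]) auto
  have run: "\<exists>t s. exec w A (entry [T, pat]) t s \<and> arr s 2 = TPHD T pat \<and> ?m + X + t \<le> h"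
    if pat: "length pat = X" "set pat \<subseteq> set S" for pat
  proof -
    have "wide c w (?m # length pat # T @ pat)"
      using pat by (intro wide_mono[OF wide]) auto
    moreover have "set pat \<subseteq> \<Sigma>" "pat \<noteq> []"
      using pat ST(1) X(1) by auto
    ultimately obtain t s where ts: "exec w A (entry [T, pat]) t s" "arr s 2 = TPHD T pat"
      "real (input_size [T, pat] + t) \<le> T_HD ?m (length pat) \<Sigma>"
      using A ST(2) unfolding solves_TPHD_def by blast
    then have "real (?m + X + t) \<le> H"
      using pat(1) by (simp add: H_def input_size_def)
    then show ?thesis
      using ts(1,2) unfolding h_def by (intro exI[of _ t] exI[of _ s]) linarith
  qed
  \<comment> \<open>Reading its input bounds the time of \<open>A\<close> from below. A constant
    pattern shows this even if \<open>S\<close> has no full block; it also makes \<open>H\<close>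
    positive, so \<open>nat\<close> cuts nothing off.\<close>
  have h: "?m + X \<le> h"
  proof -
    have "hd S \<in> set S"
      using ST(4) by simp
    then have "set (replicate X (hd S)) \<subseteq> set S"
      by auto
    then show ?thesis
      using run[of "replicate X (hd S)"] by auto
  qed
  then have hH: "real h \<le> H"
    using X(1) unfolding h_def by linarith
  obtain t s where pre: "exec w (pre A) (entry [S, T, [X]]) t s"
    "t \<le> (?n div X) * (h + 40 * X + 80 * (?m + 1) + 200) + 100" "loop_inv X S T 0 s"
    using runs_pre[OF _ word run] X(1) unfolding runs_def by auto
  have "real (input_size [S, T, [X]] + t)
      \<le> real (?n + ?m + 1 + ((?n div X) * (h + 40 * X + 80 * (?m + 1) + 200) + 100))"
    using pre(2) by (intro of_nat_mono) (simp add: input_size_def)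
  also have "\<dots> \<le> 1000 * (real ?n / x * H)"
    by (rule pre_time_bound) (use x(1) X ST(3,4) h hH in auto)
  finally have time: "real (input_size [S, T, [X]] + t) \<le> 1000 * (real ?n / x * H)" .
  have "answers_SHD w qry S T s (1000 * min (real ?m) x)"
    unfolding answers_SHD_def
  proof (intro allI impI, elim conjE)
    fix s' i j
    assume s': "after_queries w qry ?n ?m s s'" and ij: "i \<in> {1..?n}" "j \<in> {1..?m}"
    have "done_from X S T 0 = blocks X S T"
      by (simp add: done_from_def fun_eq_iff)
    then have "runs w qry (ask i j s') (60 * min ?m X + 400)
        (\<lambda>s''. scal s'' 2 = HD (drop (i - 1) S) (drop (j - 1) T))"
      using pre(3) X(1) word ij
      by (intro runs_qry) (auto simp: loop_inv_def after_queries_arr[OF s'])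
    then obtain t' s'' where q: "exec w qry (ask i j s') t' s''" "t' \<le> 60 * min ?m X + 400"
      "scal s'' 2 = HD (drop (i - 1) S) (drop (j - 1) T)"
      unfolding runs_def by blast
    \<comment> \<open>The minimum is at least 1, so it absorbs the additive 400.\<close>
    have "t' \<le> 460 * min ?m X"
      using q(2) ij X(1) by (auto simp: min_def)
    then have "real t' \<le> 460 * min (real ?m) (real X)"
      by (metis of_nat_le_iff of_nat_min of_nat_mult of_nat_numeral)
    also have "\<dots> \<le> 1000 * min (real ?m) x"
      using X(3) x(1) by (auto simp: min_def)
    finally show "\<exists>t s''. exec w qry (ask i j s') t s'' \<and>
        scal s'' 2 = HD (drop (i - 1) S) (drop (j - 1) T) \<and> real t \<le> 1000 * min (real ?m) x"
      using q by blast
  qed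
  then show ?thesis
    unfolding SHD_oracle_def using pre(1) time by (auto simp: H_def)
qed

theorem theorem1:
  "\<exists>C > (0::real). \<forall>(A :: com) (c :: nat). \<exists>(pre :: com) (qry :: com) (c' :: nat).
     \<forall>(\<Sigma> :: nat set) (T_HD :: nat \<Rightarrow> nat \<Rightarrow> nat set \<Rightarrow> real).
       solves_TPHD A c \<Sigma> T_HD \<longrightarrow>
       (\<forall>(x :: real) (X :: nat) (S :: nat list) (T :: nat list) (n :: nat) (m :: nat) (w :: nat).
          x \<ge> 1 \<and> X \<in> {nat \<lfloor>x\<rfloor>, nat \<lceil>x\<rceil>} \<and>
          set S \<subseteq> \<Sigma> \<and> set T \<subseteq> \<Sigma> \<and> length S = n \<and> length T = m \<and> m \<le> n \<and> n > 0 \<and>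
          wide c' w (n # m # X # S @ T) \<longrightarrow>
          SHD_oracle w pre qry S T X
            (C * (real n / x * T_HD m X \<Sigma>))
            (C * min (real m) x))"
  \<comment> \<open>The witnesses are \<open>pre A\<close>, \<open>qry\<close> and
    \<open>c + 4\<close>: exponent \<open>c\<close> serves the calls of \<open>A\<close>, exponent 4
    the index arithmetic. The constant 1000 is independent of \<open>A\<close>.\<close>
  using oracle_correct
  by (intro exI[of _ "1000 :: real"] conjI allI) (simp, blast)

end
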